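(* Let $G=(V,E)\in\mathcal{G}$, let $\omega^u$ be an MCP upper-bound function (not assumed increasing), let $K\subseteq V$ be a set of size $k$, let $0\le d\le k-2$, and let $G'=\mathrm{truss}(G,k-2,d,\omega^u)$ be the output of the peeling procedure described in the context. Then $$K\text{ is a clique in }G\iff K\text{ is a clique in }G'.$$
   Context: $\mathcal{G}$ is the class of all finite, simple, undirected graphs, and $\mathbb{N}_0=\{0,1,2,\dots\}$. Vertices are labeled by distinct natural numbers and ordered by label; $N_G(v)$ is the neighborhood of $v$ and $N_G^+(v)=\{u\in N_G(v):v<u\}$. $G[S]$ is the induced subgraph, $\overline{uv}$ is the edge joining $u,v$, $G\setminus\overline{uv}$ is edge deletion, and $\omega(G)$ is the clique number. A clique in $G$ is a set of pairwise adjacent vertices of $G$. $\omega^u:\mathcal{G}\to\mathbb{N}_0$ is an MCP upper-bound function if $\omega(G)\le\omega^u(G)\le|V(G)|$ for all $G\in\mathcal{G}$; it is edge-sensitive if $\omega^u(G)\ne\omega^u(G\setminus\overline{uv})$ for some $G\in\mathcal{G}$ and some edge $\overline{uv}$ of $G$. For integers $0\le d\le k$, procedure $\mathrm{cond}(v_1,v_2,G)$ (with parameters $k,d,\omega^u$): let $S=N_G(v_1)\cap N_G(v_2)$ and return $\text{c-rec}(\emptyset,S,S)$, where $\text{c-rec}(R,W,B)$ is defined recursively: if $|R|=d$, return the truth value of $\omega^u(G[W])\ge k-d$; otherwise return $\bigvee_{v\in B}\text{c-rec}\big(R\cup\{v\},\,W\cap N_G(v),\,B\cap N_G^+(v)\big)$.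 (Equivalently, it decides whether there is a $(d+2)$-clique $K'\ni v_1,v_2$ of $G$ with $\omega^u\big(G[\bigcap_{x\in K'}N_G(x)]\big)\ge k-d$.) Procedure $\mathrm{truss}(G,k,d,\omega^u)$: set $Q_E\leftarrow E(G)$. While $Q_E\ne\emptyset$: pick and remove an (arbitrary) edge $\overline{v_1v_2}$ from $Q_E$; if $\mathrm{cond}(v_1,v_2,G)$ is false for the current graph $G$, then let $S=N_G(v_1)\cap N_G(v_2)$; add to $Q_E$ all edges $\overline{wv_1},\overline{wv_2}$ with $w\in S$; if $d>0$ or $\omega^u$ is edge-sensitive, also add to $Q_E$ all edges $\overline{w_1w_2}$ with $w_1\in S$, $w_2\in S\cap N_G(w_1)$; then set $G\leftarrow G\setminus\overline{v_1v_2}$. When $Q_E=\emptyset$, return the current $G$. *)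

theory Defs
  imports Main
begin

datatype graph = Graph (verts: "nat set") (edges: "nat set set")

definition simple_graph :: "graph \<Rightarrow> bool" where
  "simple_graph G \<longleftrightarrow> finite (verts G) \<and> (\<forall>e\<in>edges G. e \<subseteq> verts G \<and> card e = 2)"

definition nbh :: "graph \<Rightarrow> nat \<Rightarrow> nat set" where
  "nbh G v = {u. {v, u} \<in> edges G}"

definition nbh_plus :: "graph \<Rightarrow> nat \<Rightarrow> nat set" where
  "nbh_plus G v = {u \<in> nbh G v. v < u}"

definition induced :: "graph \<Rightarrow> nat set \<Rightarrow> graph" where
  "induced G S = Graph S {e \<in> edges G. e \<subseteq> S}"

definition del_edge :: "graph \<Rightarrow> nat set \<Rightarrow> graph" where
  "del_edge G e = Graph (verts G) (edges G - {e})"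

definition clique :: "graph \<Rightarrow> nat set \<Rightarrow> bool" where
  "clique G K \<longleftrightarrow> K \<subseteq> verts G \<and> (\<forall>u\<in>K. \<forall>v\<in>K. u \<noteq> v \<longrightarrow> {u, v} \<in> edges G)"

definition clique_number :: "graph \<Rightarrow> nat" where
  "clique_number G = Max {card K | K. clique G K}"

text \<open>Values outside the class of finite simple graphs are irrelevant. No invariance
  under isomorphism is required: graphs are labelled.\<close>

definition mcp_upper_bound :: "(graph \<Rightarrow> nat) \<Rightarrow> bool" where
  "mcp_upper_bound \<omega>u \<longleftrightarrow>
     (\<forall>G. simple_graph G \<longrightarrow> clique_number G \<le> \<omega>u G \<and> \<omega>u G \<le> card (verts G))"

definition edge_sensitive :: "(graph \<Rightarrow> nat) \<Rightarrow> bool" where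
  "edge_sensitive \<omega>u \<longleftrightarrow> (\<exists>G. simple_graph G \<and> (\<exists>e\<in>edges G. \<omega>u G \<noteq> \<omega>u (del_edge G e)))"

text \<open>The conjunct \<open>finite B\<close> only makes the recursion total; every candidate set arising
  in a finite graph is finite. The recursion terminates because \<open>v\<close> is in \<open>B\<close> but not in
  \<open>nbh_plus G v\<close>.\<close>

declare conj_cong [fundef_cong]

function c_rec :: "nat \<Rightarrow> nat \<Rightarrow> (graph \<Rightarrow> nat) \<Rightarrow> graph \<Rightarrow> nat set \<Rightarrow> nat set \<Rightarrow> nat set \<Rightarrow> bool" where
  "c_rec k d \<omega>u G R W B =
     (if card R = d then \<omega>u (induced G W) \<ge> k - d
      else finite B \<and>
        (\<exists>v\<in>B. c_rec k d \<omega>u G (R \<union> {v}) (W \<inter> nbh G v) (B \<inter> nbh_plus G v)))"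
  by pat_completeness auto
termination
proof (relation "measure (\<lambda>(k, d, \<omega>u, G, R, W, B). card B)", goal_cases)
  case (2 k d \<omega>u G R W B v)
  then have "B \<inter> nbh_plus G v \<subset> B"
    by (auto simp: nbh_plus_def)
  with 2 show ?case
    by (simp add: psubset_card_mono)
qed simp

declare c_rec.simps [simp del]

definition truss_cond :: "nat \<Rightarrow> nat \<Rightarrow> (graph \<Rightarrow> nat) \<Rightarrow> nat \<Rightarrow> nat \<Rightarrow> graph \<Rightarrow> bool" where
  "truss_cond k d \<omega>u v1 v2 G =
     (let S = nbh G v1 \<inter> nbh G v2 in c_rec k d \<omega>u G {} S S)"

definition requeued :: "nat \<Rightarrow> (graph \<Rightarrow> nat) \<Rightarrow> nat \<Rightarrow> nat \<Rightarrow> graph \<Rightarrow> nat set set" where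
  "requeued d \<omega>u v1 v2 G =
     (let S = nbh G v1 \<inter> nbh G v2 in
        {{w, v1} | w. w \<in> S} \<union> {{w, v2} | w. w \<in> S} \<union>
        (if d > 0 \<or> edge_sensitive \<omega>u
         then {{w1, w2} | w1 w2. w1 \<in> S \<and> w2 \<in> S \<inter> nbh G w1} else {}))"

text \<open>One iteration of the loop, on states consisting of the queue and the current graph.
  Since the edge taken from the queue is arbitrary, this is a relation.\<close>

inductive truss_step :: "nat \<Rightarrow> nat \<Rightarrow> (graph \<Rightarrow> nat) \<Rightarrow>
    nat set set \<times> graph \<Rightarrow> nat set set \<times> graph \<Rightarrow> bool"
  for k d \<omega>u where
  keep: "{v1, v2} \<in> Q \<Longrightarrow> truss_cond k d \<omega>u v1 v2 G \<Longrightarrow>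
    truss_step k d \<omega>u (Q, G) (Q - {{v1, v2}}, G)"
| delete: "{v1, v2} \<in> Q \<Longrightarrow> \<not> truss_cond k d \<omega>u v1 v2 G \<Longrightarrow>
    truss_step k d \<omega>u (Q, G)
      ((Q - {{v1, v2}}) \<union> requeued d \<omega>u v1 v2 G, del_edge G {v1, v2})"

text \<open>\<open>truss G k d \<omega>u G'\<close>: some run of the procedure on \<open>G\<close> returns \<open>G'\<close>.\<close>

definition truss :: "graph \<Rightarrow> nat \<Rightarrow> nat \<Rightarrow> (graph \<Rightarrow> nat) \<Rightarrow> graph \<Rightarrow> bool" where
  "truss G k d \<omega>u G' \<longleftrightarrow> (truss_step k d \<omega>u)\<^sup>*\<^sup>* (edges G, G) ({}, G')"

text \<open>The relation \<open>truss\<close> is not vacuous: every simple graph has an output.\<close>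

lemma simple_graph_finite_edges: "simple_graph G \<Longrightarrow> finite (edges G)"
  by (rule finite_subset[of _ "Pow (verts G)"]) (auto simp: simple_graph_def)

lemma simple_graph_del_edge: "simple_graph G \<Longrightarrow> simple_graph (del_edge G e)"
  by (auto simp: simple_graph_def del_edge_def)

lemma requeued_subset:
  assumes "simple_graph G"
  shows "requeued d \<omega>u v1 v2 G \<subseteq> edges G - {{v1, v2}}"
proof -
  have loop: "{v} \<notin> edges G" for v
    using assms by (auto simp: simple_graph_def)
  show ?thesis
    by (auto simp: requeued_def Let_def nbh_def insert_commute doubleton_eq_iff loop
        split: if_splits)
qed

lemma truss_terminates:
  assumes "simple_graph G" "Q \<subseteq> edges G"
  shows "\<exists>G'. (truss_step k d \<omega>u)\<^sup>*\<^sup>* (Q, G) ({}, G')"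
  using assms
proof (induction "(card (edges G), card Q)" arbitrary: G Q
    rule: wf_induct_rule[OF wf_lex_prod[OF wf_less_than wf_less_than]])
  case (1 G Q)
  have fin: "finite (edges G)" "finite Q"
    using 1 simple_graph_finite_edges finite_subset by blast+
  show ?case
  proof (cases "Q = {}")
    case False
    then obtain e where e: "e \<in> Q" by blast
    then have "card e = 2" using 1 by (auto simp: simple_graph_def)
    then obtain v1 v2 where v: "e = {v1, v2}" by (auto simp: card_2_iff)
    show ?thesis
    proof (cases "truss_cond k d \<omega>u v1 v2 G")
      case True
      have "card (Q - {e}) < card Q" using e fin by (meson card_Diff1_less)
      then have "\<exists>G'. (truss_step k d \<omega>u)\<^sup>*\<^sup>* (Q - {e}, G) ({}, G')"
        using 1 by auto
      then show ?thesis
        using keep[of v1 v2 Q k d \<omega>u G] True e v by (meson converse_rtranclp_into_rtranclp)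
    next
      case False
      let ?Q = "(Q - {e}) \<union> requeued d \<omega>u v1 v2 G"
      have "card (edges (del_edge G e)) < card (edges G)"
        using e 1 fin by (auto simp: del_edge_def intro!: card_Diff1_less)
      moreover have "?Q \<subseteq> edges (del_edge G e)"
        using requeued_subset[of G d \<omega>u v1 v2] 1 v by (auto simp: del_edge_def)
      ultimately have "\<exists>G'. (truss_step k d \<omega>u)\<^sup>*\<^sup>* (?Q, del_edge G e) ({}, G')"
        using 1 by (simp add: simple_graph_del_edge)
      then show ?thesis
        using delete[of v1 v2 Q k d \<omega>u G] False e v by (meson converse_rtranclp_into_rtranclp)
    qed
  qed blast
qed

lemma truss_output_exists: "simple_graph G \<Longrightarrow> \<exists>G'. truss G k d \<omega>u G'"
  unfolding truss_def by (rule truss_terminates) auto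

end

theory Submission
  imports Defs
begin

text \<open>
  Peeling only deletes edges, so a clique of the output is a clique of the input. For the
  converse, no edge of a \<open>k\<close>-clique \<open>K\<close> is ever deleted: as long as \<open>K\<close> is a clique of the
  current graph, the edge joining \<open>v1\<close> and \<open>v2\<close> in \<open>K\<close> has the \<open>(k - 2)\<close>-clique
  \<open>K - {v1, v2}\<close> in its common neighbourhood. Choosing the \<open>d\<close> smallest vertices of that
  clique for \<open>R\<close> is an admissible branch of the recursive search, and the remaining
  \<open>k - 2 - d\<close> vertices form a clique in the set \<open>W\<close> reached there. The bound on \<open>W\<close> is then
  at least \<open>k - 2 - d\<close>, so the condition holds and the edge is kept
  (\<open>c_rec_of_clique\<close>, \<open>truss_cond_of_clique\<close>).

  Each test concerns only the graph current at that moment, and never relates the bounds of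
  two different graphs. Hence being simple and having \<open>K\<close> as a clique are invariants of a
  single step, whatever edge is taken from the queue, and induction along the run gives the
  claim.
\<close>

lemma simple_graph_induced:
  assumes "simple_graph G" "W \<subseteq> verts G"
  shows "simple_graph (induced G W)"
  using assms finite_subset[of W "verts G"] by (auto simp: simple_graph_def induced_def)

lemma clique_subset: "clique G C \<Longrightarrow> D \<subseteq> C \<Longrightarrow> clique G D"
  by (auto simp: clique_def)

lemma card_clique_le_clique_number:
  assumes "simple_graph G" "clique G C"
  shows "card C \<le> clique_number G"
proof -
  have "{card K | K. clique G K} \<subseteq> card ` Pow (verts G)"
    by (auto simp: clique_def)
  then have "finite {card K | K. clique G K}"
    using assms(1) by (simp add: simple_graph_def finite_subset)
  then show ?thesis
    using assms(2) by (auto simp: clique_number_def intro: Max_ge)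
qed

lemma nbh_subset_verts: "simple_graph G \<Longrightarrow> nbh G v \<subseteq> verts G"
  by (auto simp: simple_graph_def nbh_def)

text \<open>
  The search succeeds because it can always move the least vertex of the clique \<open>C\<close> still
  available into \<open>R\<close>: the rest of \<open>C\<close> consists of larger neighbours of that vertex, so it
  survives both intersections and the sum of the sizes of \<open>R\<close> and \<open>C\<close> does not change.
  Disjointness of \<open>R\<close> and \<open>B\<close> ensures that each move enlarges \<open>R\<close>.
\<close>

lemma c_rec_of_clique:
  assumes "simple_graph G" "mcp_upper_bound \<omega>u"
    and "clique G C" "C \<subseteq> W" "C \<subseteq> B" "W \<subseteq> verts G"
    and "finite B" "finite R" "R \<inter> B = {}"
    and "card R \<le> d" "d \<le> k" "k \<le> card R + card C"
  shows "c_rec k d \<omega>u G R W B"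
  using assms
proof (induction "d - card R" arbitrary: R W B C)
  case 0
  let ?H = "induced G W"
  have H: "simple_graph ?H"
    using 0 by (simp add: simple_graph_induced)
  have "clique ?H C"
    using 0 by (auto simp: clique_def induced_def)
  then have "card C \<le> clique_number ?H"
    using H by (rule card_clique_le_clique_number[rotated])
  also have "\<dots> \<le> \<omega>u ?H"
    using 0 H by (simp add: mcp_upper_bound_def)
  finally show ?case
    using 0 by (subst c_rec.simps) simp
next
  case (Suc n)
  have fin: "finite C"
    using Suc.prems(5,7) by (rule finite_subset)
  have "C \<noteq> {}"
    using Suc.prems(11,12) Suc.hyps(2) by auto
  define v where "v = Min C"
  have v: "v \<in> C"
    using fin \<open>C \<noteq> {}\<close> by (simp add: v_def)
  have larger: "C - {v} \<subseteq> nbh_plus G v"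
  proof
    fix u assume u: "u \<in> C - {v}"
    then have "v \<le> u"
      using fin by (simp add: v_def)
    then show "u \<in> nbh_plus G v"
      using u v Suc.prems(3) by (auto simp: nbh_plus_def nbh_def clique_def)
  qed
  have "v \<notin> R"
    using v Suc.prems by blast
  then have card_R: "card (R \<union> {v}) = Suc (card R)"
    using Suc.prems by simp
  have card_C: "card C = Suc (card (C - {v}))"
    using fin v by (rule card.remove)
  have "c_rec k d \<omega>u G (R \<union> {v}) (W \<inter> nbh G v) (B \<inter> nbh_plus G v)"
  proof (rule Suc.hyps(1)[where C = "C - {v}"])
    show "clique G (C - {v})"
      using Suc.prems(3) by (rule clique_subset) auto
    show "C - {v} \<subseteq> W \<inter> nbh G v" "C - {v} \<subseteq> B \<inter> nbh_plus G v"
      using larger Suc.prems by (auto simp: nbh_plus_def)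
    show "(R \<union> {v}) \<inter> (B \<inter> nbh_plus G v) = {}"
      using Suc.prems by (auto simp: nbh_plus_def)
  qed (use Suc.prems Suc.hyps(2) card_R card_C in auto)
  moreover have "v \<in> B" "card R \<noteq> d"
    using v Suc.prems(5) Suc.hyps(2) by auto
  ultimately show ?case
    using Suc.prems(7) by (subst c_rec.simps) auto
qed

lemma truss_cond_of_clique:
  assumes G: "simple_graph G" and bound: "mcp_upper_bound \<omega>u"
    and K: "clique G K" and v: "v1 \<in> K" "v2 \<in> K" "v1 \<noteq> v2"
    and d: "d \<le> card K - 2"
  shows "truss_cond (card K - 2) d \<omega>u v1 v2 G"
proof -
  let ?S = "nbh G v1 \<inter> nbh G v2" and ?C = "K - {v1, v2}"
  have S: "?S \<subseteq> verts G"
    using nbh_subset_verts[OF G] by blast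
  then have fin: "finite ?S"
    using G finite_subset[of ?S "verts G"] by (simp add: simple_graph_def)
  have C: "?C \<subseteq> ?S"
    using K v by (auto simp: clique_def nbh_def)
  have "card ?C = card K - 2"
    using v by (simp add: card_Diff_subset)
  then have "c_rec (card K - 2) d \<omega>u G {} ?S ?S"
    using G bound clique_subset[OF K, of ?C] C S fin d
    by (intro c_rec_of_clique[where C = ?C]) auto
  then show ?thesis
    by (simp add: truss_cond_def)
qed

lemma truss_step_preserves_clique:
  assumes step: "truss_step (card K - 2) d \<omega>u s t"
    and "simple_graph (snd s)" "mcp_upper_bound \<omega>u" "d \<le> card K - 2"
    and K: "clique (snd s) K"
  shows "clique (snd t) K"
  using step
proof cases
  case (keep v1 v2 Q G)
  then show ?thesis
    using K by simp
next
  case (delete v1 v2 Q G)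
  (* A degenerate pair v1 = v2 is harmless: deleting a singleton removes no edge between
     distinct vertices. *)
  then have "\<not> (v1 \<in> K \<and> v2 \<in> K \<and> v1 \<noteq> v2)"
    using truss_cond_of_clique[of G \<omega>u K v1 v2 d] assms by auto
  then show ?thesis
    using K delete by (auto simp: clique_def del_edge_def doubleton_eq_iff)
qed

lemma truss_step_preserves_simple_graph:
  "truss_step k d \<omega>u s t \<Longrightarrow> simple_graph (snd s) \<Longrightarrow> simple_graph (snd t)"
  by (erule truss_step.cases) (simp_all add: simple_graph_del_edge)

lemma truss_step_reflects_clique:
  "truss_step k d \<omega>u s t \<Longrightarrow> clique (snd t) K \<Longrightarrow> clique (snd s) K"
  by (erule truss_step.cases) (auto simp: clique_def del_edge_def)

theorem proposition20:
  fixes G G' :: graph and \<omega>u :: "graph \<Rightarrow> nat" and K :: "nat set" and k d :: nat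
  assumes "simple_graph G"
    and "mcp_upper_bound \<omega>u"
    and "K \<subseteq> verts G" and "card K = k"
    and "2 \<le> k" and "d \<le> k - 2"
    and "truss G (k - 2) d \<omega>u G'"
  shows "clique G K \<longleftrightarrow> clique G' K"
proof -
  have run: "(truss_step (card K - 2) d \<omega>u)\<^sup>*\<^sup>* (edges G, G) ({}, G')"
    using assms(4,7) by (simp add: truss_def)
  have "simple_graph (snd t) \<and> (clique G K \<longleftrightarrow> clique (snd t) K)"
    if "(truss_step (card K - 2) d \<omega>u)\<^sup>*\<^sup>* (edges G, G) t" for t
    using that
  proof induction
    case base
    show ?case
      using assms(1) by simp
  next
    case (step s t)
    then show ?case
      using truss_step_preserves_clique[of K d \<omega>u s t]
        truss_step_reflects_clique[of "card K - 2" d \<omega>u s t K]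
        truss_step_preserves_simple_graph[of "card K - 2" d \<omega>u s t] assms(2,4,6)
      by blast
  qed
  from this[OF run] show ?thesis
    by simp
qed

end
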